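(* Let $n \ge 2$. Then $|A^+(B_n)| = (n!+1)n^2 + n^4 + 1$. In fact, the elements of $A^+(B_n)$ break up as follows. (1) The number of mappings in $A^+(B_n)$ of full support (i.e. of $(n^2+1)$-support) is $n^2$. (2) The number of mappings in $A^+(B_n)$ of $n$-support is $(n!)n^2$. (3) The number of mappings in $A^+(B_n)$ of singleton support (i.e. of $1$-support) is $n^4$. (4) The number of mappings in $A^+(B_n)$ of $0$-support is $1$.
   Context: For $n\ge 1$ let $[n]=\{1,\dots,n\}$. The Brandt semigroup $(B_n,+)$ has underlying set $B_n=([n]\times[n])\cup\{\vartheta\}$ with $(i,j)+(k,l)=(i,l)$ if $j=k$, $(i,j)+(k,l)=\vartheta$ if $j\ne k$, and $\alpha+\vartheta=\vartheta+\alpha=\vartheta$ for all $\alpha\in B_n$. $M(B_n)$ is the set of all maps $B_n\to B_n$; arguments are written on the left of functions. It carries pointwise addition $\alpha(f+g)=\alpha f+\alpha g$ and composition $\alpha(f\circ g)=(\alpha f)g$. An affine map over $B_n$ is a map of the form $g+h$ with $g$ an endomorphism of the semigroup $(B_n,+)$ (not required to fix $\vartheta$) and $h\in M(B_n)$ a constant map. $A^+(B_n)$ (the affine near-semiring over $B_n$) is the smallest subset of $M(B_n)$ that contains all affine maps and is closed under $+$ and $\circ$. The support of $f\in M(B_n)$ is $\mathrm{supp}(f)=\{\alpha\in B_n : \alpha f\neq\vartheta\}$; $f$ is of $k$-support if $|\mathrm{supp}(f)|=k$. *)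

theory Defs
  imports "HOL-Library.FuncSet"
begin

text \<open>The ambient type contains the Brandt semigroups of all ranks; the addition does not depend
  on the rank, and \<open>B\<^sub>n\<close> is the subset \<open>brandt n\<close>.\<close>

datatype brandt_elt = Elt nat nat | Theta

instantiation brandt_elt :: semigroup_add
begin

fun plus_brandt_elt :: "brandt_elt \<Rightarrow> brandt_elt \<Rightarrow> brandt_elt" where
  "Elt i j + Elt k l = (if j = k then Elt i l else Theta)"
| "Theta + b = Theta"
| "Elt i j + Theta = Theta"

instance
proof
  fix a b c :: brandt_elt
  show "a + b + c = a + (b + c)"
    by (cases a; cases b; cases c) auto
qed

end

definition brandt :: "nat \<Rightarrow> brandt_elt set" where
  "brandt n = {Elt i j | i j. i \<in> {1..n} \<and> j \<in> {1..n}} \<union> {Theta}"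

text \<open>Maps \<open>B\<^sub>n \<rightarrow> B\<^sub>n\<close> are extensional functions (\<open>undefined\<close> outside \<open>brandt n\<close>), so that
  HOL equality is equality of maps on \<open>B\<^sub>n\<close> and cardinalities count maps on \<open>B\<^sub>n\<close>.\<close>

definition maps :: "nat \<Rightarrow> (brandt_elt \<Rightarrow> brandt_elt) set" where
  "maps n = brandt n \<rightarrow>\<^sub>E brandt n"

definition pointwise_add ::
    "nat \<Rightarrow> (brandt_elt \<Rightarrow> brandt_elt) \<Rightarrow> (brandt_elt \<Rightarrow> brandt_elt) \<Rightarrow> brandt_elt \<Rightarrow> brandt_elt" where
  "pointwise_add n f g = (\<lambda>a\<in>brandt n. f a + g a)"

text \<open>Arguments are written on the left in the source, so \<open>f \<circ> g\<close> there applies \<open>f\<close> first.\<close>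

definition compose_left ::
    "nat \<Rightarrow> (brandt_elt \<Rightarrow> brandt_elt) \<Rightarrow> (brandt_elt \<Rightarrow> brandt_elt) \<Rightarrow> brandt_elt \<Rightarrow> brandt_elt" where
  "compose_left n f g = compose (brandt n) g f"

text \<open>Endomorphisms need not fix \<open>Theta\<close>.\<close>

definition endos :: "nat \<Rightarrow> (brandt_elt \<Rightarrow> brandt_elt) set" where
  "endos n = {g \<in> maps n. \<forall>a\<in>brandt n. \<forall>b\<in>brandt n. g (a + b) = g a + g b}"

definition const_maps :: "nat \<Rightarrow> (brandt_elt \<Rightarrow> brandt_elt) set" where
  "const_maps n = {(\<lambda>a\<in>brandt n. c) | c. c \<in> brandt n}"

definition affine_maps :: "nat \<Rightarrow> (brandt_elt \<Rightarrow> brandt_elt) set" where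
  "affine_maps n = {pointwise_add n g h | g h. g \<in> endos n \<and> h \<in> const_maps n}"

inductive_set A_plus :: "nat \<Rightarrow> (brandt_elt \<Rightarrow> brandt_elt) set" for n :: nat where
  affine: "f \<in> affine_maps n \<Longrightarrow> f \<in> A_plus n"
| add: "f \<in> A_plus n \<Longrightarrow> g \<in> A_plus n \<Longrightarrow> pointwise_add n f g \<in> A_plus n"
| comp: "f \<in> A_plus n \<Longrightarrow> g \<in> A_plus n \<Longrightarrow> compose_left n f g \<in> A_plus n"

definition supp :: "nat \<Rightarrow> (brandt_elt \<Rightarrow> brandt_elt) \<Rightarrow> brandt_elt set" where
  "supp n f = {a \<in> brandt n. f a \<noteq> Theta}"

definition of_support :: "nat \<Rightarrow> nat \<Rightarrow> (brandt_elt \<Rightarrow> brandt_elt) \<Rightarrow> bool" where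
  "of_support n k f \<longleftrightarrow> card (supp n f) = k"

lemma brandt_add_closed: "a \<in> brandt n \<Longrightarrow> b \<in> brandt n \<Longrightarrow> a + b \<in> brandt n"
  by (cases a; cases b) (simp_all add: brandt_def)

lemma maps_mem: "f \<in> maps n \<Longrightarrow> a \<in> brandt n \<Longrightarrow> f a \<in> brandt n"
  by (auto simp: maps_def)

lemma A_plus_subset_maps: "A_plus n \<subseteq> maps n"
proof
  fix f assume "f \<in> A_plus n"
  then show "f \<in> maps n"
  proof (induction rule: A_plus.induct)
    case (affine f)
    then obtain g h where f: "f = pointwise_add n g h" and "g \<in> maps n" "h \<in> maps n"
      unfolding affine_maps_def endos_def const_maps_def maps_def by auto
    then have "g a + h a \<in> brandt n" if "a \<in> brandt n" for a
      using that by (simp add: brandt_add_closed maps_mem)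
    then show ?case
      unfolding f maps_def pointwise_add_def by (subst restrict_PiE_iff) blast
  next
    case (add f g)
    then have "f a + g a \<in> brandt n" if "a \<in> brandt n" for a
      using that by (simp add: brandt_add_closed maps_mem)
    then show ?case
      unfolding maps_def pointwise_add_def by (subst restrict_PiE_iff) blast
  next
    case (comp f g)
    then have "g (f a) \<in> brandt n" if "a \<in> brandt n" for a
      using that by (simp add: maps_mem)
    then show ?case
      unfolding maps_def compose_left_def compose_def by (subst restrict_PiE_iff) blast
  qed
qed

end

theory Submission
  imports Defs "HOL-Combinatorics.Permutations"
begin

text \<open>An endomorphism of the Brandt semigroup is either constant or induced by a permutation of the
  indices. Adding a constant turns the latter into a map \<open>column_map k q s\<close>, which sends \<open>(i, k)\<close> to
  \<open>(s i, q)\<close> and everything else to the zero element. The constants, these column maps and the maps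
  with at most one nonzero value are closed under both operations, and each singleton-support map is
  a sum of two column maps. Injective parametrisations of the classes give the counts.\<close>

section \<open>Families of maps and their basic properties\<close>

definition nonzeros :: "nat \<Rightarrow> brandt_elt set" where
  "nonzeros n = (\<lambda>(i, j). Elt i j) ` ({1..n} \<times> {1..n})"

definition const_map :: "nat \<Rightarrow> brandt_elt \<Rightarrow> brandt_elt \<Rightarrow> brandt_elt" where
  "const_map n c = (\<lambda>a\<in>brandt n. c)"

definition index_map :: "nat \<Rightarrow> (nat \<Rightarrow> nat) \<Rightarrow> brandt_elt \<Rightarrow> brandt_elt" where
  "index_map n s = (\<lambda>a\<in>brandt n. case a of Elt i j \<Rightarrow> Elt (s i) (s j) | Theta \<Rightarrow> Theta)"

text \<open>Recording \<open>k\<close> in place of the first index \<open>s k\<close> of the added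
  constant makes the support visible in the parameters.\<close>

definition column_map :: "nat \<Rightarrow> nat \<Rightarrow> nat \<Rightarrow> (nat \<Rightarrow> nat) \<Rightarrow> brandt_elt \<Rightarrow> brandt_elt" where
  "column_map n k q s =
    (\<lambda>a\<in>brandt n. case a of Elt i j \<Rightarrow> if j = k then Elt (s i) q else Theta | Theta \<Rightarrow> Theta)"

definition single_map :: "nat \<Rightarrow> brandt_elt \<Rightarrow> brandt_elt \<Rightarrow> brandt_elt \<Rightarrow> brandt_elt" where
  "single_map n a b = (\<lambda>x\<in>brandt n. if x = a then b else Theta)"

definition column_maps :: "nat \<Rightarrow> (brandt_elt \<Rightarrow> brandt_elt) set" where
  "column_maps n =
    (\<lambda>(k, q, s). column_map n k q s) ` ({1..n} \<times> {1..n} \<times> {s. s permutes {1..n}})"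

text \<open>Phrased through the support rather than as a list of maps, so that closure becomes a
  matter of shrinking supports. \<open>f Theta = Theta\<close> rules out a map whose only nonzero
  value sits at \<open>Theta\<close>.\<close>

definition small_maps :: "nat \<Rightarrow> (brandt_elt \<Rightarrow> brandt_elt) set" where
  "small_maps n = {f \<in> maps n. f Theta = Theta \<and>
    (\<forall>x\<in>brandt n. \<forall>y\<in>brandt n. f x \<noteq> Theta \<longrightarrow> f y \<noteq> Theta \<longrightarrow> x = y)}"

lemma Elt_in_brandt [simp]: "Elt i j \<in> brandt n \<longleftrightarrow> i \<in> {1..n} \<and> j \<in> {1..n}"
  by (auto simp: brandt_def)

lemma Theta_in_brandt [simp]: "Theta \<in> brandt n"
  by (simp add: brandt_def)

lemma Elt_in_nonzeros [simp]: "Elt i j \<in> nonzeros n \<longleftrightarrow> i \<in> {1..n} \<and> j \<in> {1..n}"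
  by (auto simp: nonzeros_def)

lemma Theta_notin_nonzeros [simp]: "Theta \<notin> nonzeros n"
  by (auto simp: nonzeros_def)

lemma brandt_eq_insert: "brandt n = insert Theta (nonzeros n)"
  by (auto simp: brandt_def nonzeros_def)

lemma nonzeros_subset_brandt: "nonzeros n \<subseteq> brandt n"
  by (auto simp: brandt_eq_insert)

lemma finite_nonzeros [simp]: "finite (nonzeros n)"
  by (simp add: nonzeros_def)

lemma card_nonzeros: "card (nonzeros n) = n ^ 2"
  unfolding nonzeros_def
  by (subst card_image) (auto simp: inj_on_def power2_eq_square)

lemma add_Theta_right [simp]: "a + Theta = Theta" for a :: brandt_elt
  by (cases a) auto

lemma permutes_atLeastAtMost_mem:
  "s permutes {1..n} \<Longrightarrow> i \<in> {1..n} \<Longrightarrow> s i \<in> {1..n}"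
  by (simp only: permutes_in_image)

lemma const_maps_eq: "const_maps n = const_map n ` brandt n"
  by (auto simp: const_maps_def const_map_def)

lemma const_map_in_maps: "c \<in> brandt n \<Longrightarrow> const_map n c \<in> maps n"
  by (auto simp: const_map_def maps_def)

lemma index_map_in_maps:
  assumes "s permutes {1..n}"
  shows "index_map n s \<in> maps n"
  unfolding maps_def index_map_def
proof (subst restrict_PiE_iff, intro ballI)
  fix a assume "a \<in> brandt n"
  then show "(case a of Elt i j \<Rightarrow> Elt (s i) (s j) | Theta \<Rightarrow> Theta) \<in> brandt n"
    using permutes_atLeastAtMost_mem[OF assms] by (cases a) (simp_all del: atLeastAtMost_iff)
qed

lemma column_map_in_maps:
  assumes "s permutes {1..n}" "q \<in> {1..n}"
  shows "column_map n k q s \<in> maps n"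
  unfolding maps_def column_map_def
proof (subst restrict_PiE_iff, intro ballI)
  fix a assume "a \<in> brandt n"
  then show "(case a of Elt i j \<Rightarrow> if j = k then Elt (s i) q else Theta | Theta \<Rightarrow> Theta) \<in> brandt n"
    using permutes_atLeastAtMost_mem[OF assms(1)] assms(2)
    by (cases a) (simp_all del: atLeastAtMost_iff)
qed

lemma single_map_in_maps: "b \<in> brandt n \<Longrightarrow> single_map n a b \<in> maps n"
  by (auto simp: single_map_def maps_def)

lemma pointwise_add_in_maps:
  "f \<in> maps n \<Longrightarrow> g \<in> maps n \<Longrightarrow> pointwise_add n f g \<in> maps n"
  unfolding pointwise_add_def maps_def
  by (subst restrict_PiE_iff) (auto intro!: brandt_add_closed)

lemma compose_left_in_maps:
  "f \<in> maps n \<Longrightarrow> g \<in> maps n \<Longrightarrow> compose_left n f g \<in> maps n"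
  unfolding compose_left_def compose_def maps_def
  by (subst restrict_PiE_iff) auto

lemma maps_eqI:
  assumes "f \<in> maps n" "g \<in> maps n"
    and "f Theta = g Theta"
    and "\<And>i j. i \<in> {1..n} \<Longrightarrow> j \<in> {1..n} \<Longrightarrow> f (Elt i j) = g (Elt i j)"
  shows "f = g"
proof (rule PiE_ext)
  show "f \<in> brandt n \<rightarrow>\<^sub>E brandt n" "g \<in> brandt n \<rightarrow>\<^sub>E brandt n"
    using assms by (auto simp: maps_def)
  show "f x = g x" if "x \<in> brandt n" for x
    using that assms(3,4) by (cases x) auto
qed

lemma const_map_apply [simp]: "a \<in> brandt n \<Longrightarrow> const_map n c a = c"
  by (simp add: const_map_def)

lemma index_map_apply [simp]:
  "index_map n s Theta = Theta"
  "i \<in> {1..n} \<Longrightarrow> j \<in> {1..n} \<Longrightarrow> index_map n s (Elt i j) = Elt (s i) (s j)"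
  by (auto simp: index_map_def)

lemma column_map_apply [simp]:
  "column_map n k q s Theta = Theta"
  "i \<in> {1..n} \<Longrightarrow> j \<in> {1..n} \<Longrightarrow>
    column_map n k q s (Elt i j) = (if j = k then Elt (s i) q else Theta)"
  by (auto simp: column_map_def)

lemma single_map_apply [simp]:
  "x \<in> brandt n \<Longrightarrow> single_map n a b x = (if x = a then b else Theta)"
  by (simp add: single_map_def)

lemma pointwise_add_apply [simp]: "a \<in> brandt n \<Longrightarrow> pointwise_add n f g a = f a + g a"
  by (simp add: pointwise_add_def)

lemma compose_left_apply [simp]: "a \<in> brandt n \<Longrightarrow> compose_left n f g a = g (f a)"
  by (simp add: compose_left_def compose_def)

section \<open>Classification of endomorphisms\<close>

lemma idempotent_cases:
  fixes a :: brandt_elt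
  assumes "a + a = a" "a \<noteq> Theta"
  obtains t where "a = Elt t t"
  using assms by (cases a) (auto split: if_splits)

lemma Elt_add_eq_self: "Elt i i + a = a \<longleftrightarrow> a = Theta \<or> (\<exists>l. a = Elt i l)"
  by (cases a) auto

lemma add_Elt_eq_self: "a + Elt i i = a \<longleftrightarrow> a = Theta \<or> (\<exists>l. a = Elt l i)"
  by (cases a) auto

text \<open>An endomorphism moving \<open>Theta\<close> is forced to be constant. If it fixes
  \<open>Theta\<close> and kills one nonzero element, it kills all, since that element generates
  every other. Otherwise the idempotents \<open>Elt i i\<close> go to nonzero idempotents and stay
  orthogonal, which yields the permutation.\<close>

lemma endo_cases:
  assumes "g \<in> endos n"
  obtains (const) c where "c \<in> brandt n" "g = const_map n c"
  | (perm) s where "s permutes {1..n}" "g = index_map n s"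
proof -
  have gm: "g \<in> maps n"
    using assms by (simp add: endos_def)
  have hom: "g (a + b) = g a + g b" if "a \<in> brandt n" "b \<in> brandt n" for a b
    using assms that by (simp add: endos_def)
  have gT: "g Theta \<in> brandt n"
    by (rule maps_mem[OF gm Theta_in_brandt])
  have by_const: thesis if eq: "\<And>a. a \<in> brandt n \<Longrightarrow> g a = g Theta"
  proof -
    have "g (Elt i j) = g Theta" if "i \<in> {1..n}" "j \<in> {1..n}" for i j
      using that by (intro eq) simp
    then have "g = const_map n (g Theta)"
      by (intro maps_eqI[OF gm const_map_in_maps[OF gT]]) simp_all
    then show thesis using const gT by blast
  qed
  consider "g Theta \<noteq> Theta" | i j where "i \<in> {1..n}" "j \<in> {1..n}" "g (Elt i j) = Theta" "g Theta = Theta"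
    | "g Theta = Theta" "\<And>i j. i \<in> {1..n} \<Longrightarrow> j \<in> {1..n} \<Longrightarrow> g (Elt i j) \<noteq> Theta"
    by blast
  then show thesis
  proof cases
    case 1
    have "g Theta + g Theta = g Theta" using hom[of Theta Theta] by simp
    then obtain t where t: "g Theta = Elt t t" using 1 idempotent_cases by blast
    show thesis
    proof (rule by_const)
      fix a assume a: "a \<in> brandt n"
      \<comment> \<open>These are the images of \<open>a + Theta = Theta\<close> and
        \<open>Theta + a = Theta\<close>; only \<open>Elt t t\<close> solves them.\<close>
      have "g a + Elt t t = Elt t t" "Elt t t + g a = Elt t t"
        using hom[OF a Theta_in_brandt] hom[OF Theta_in_brandt a] t by simp_all
      then show "g a = g Theta"
        unfolding t by (cases "g a") (auto split: if_splits)
    qed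
  next
    case (2 i j)
    show thesis
    proof (rule by_const)
      fix a assume a: "a \<in> brandt n"
      show "g a = g Theta"
      proof (cases a)
        case (Elt k l)
        then have kl: "k \<in> {1..n}" "l \<in> {1..n}" using a by auto
        \<comment> \<open>\<open>Elt k l\<close> factors as
          \<open>Elt k i + Elt i j + Elt j l\<close>, so the zero value at \<open>Elt i j\<close>
          spreads.\<close>
        have "g a = g (Elt k i) + g (Elt i j + Elt j l)"
          using hom[of "Elt k i" "Elt i j + Elt j l"] kl 2 Elt by auto
        also have "\<dots> = Theta"
          using hom[of "Elt i j" "Elt j l"] kl 2 by simp
        finally show ?thesis using 2 by simp
      qed simp
    qed
  next
    case 3
    have "\<exists>t. g (Elt i i) = Elt t t" if "i \<in> {1..n}" for i
      using hom[of "Elt i i" "Elt i i"] 3(2)[OF that that] that idempotent_cases[of "g (Elt i i)"]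
      by auto
    then obtain s0 where s0: "\<And>i. i \<in> {1..n} \<Longrightarrow> g (Elt i i) = Elt (s0 i) (s0 i)" by metis
    \<comment> \<open>\<open>permutes\<close> requires the identity outside \<open>{1..n}\<close>,
      where \<open>s0\<close> is arbitrary.\<close>
    define s where "s i = (if i \<in> {1..n} then s0 i else i)" for i
    have s: "g (Elt i i) = Elt (s i) (s i)" if "i \<in> {1..n}" for i
      using s0 that by (simp add: s_def)
    have "s i \<in> {1..n}" if "i \<in> {1..n}" for i
      using maps_mem[OF gm, of "Elt i i"] s[OF that] that by auto
    moreover have inj: "inj_on s {1..n}"
    proof (rule inj_onI, rule ccontr)
      fix i j assume ij: "i \<in> {1..n}" "j \<in> {1..n}" "s i = s j" "i \<noteq> j"
      \<comment> \<open>Distinct diagonal idempotents add up to \<open>Theta\<close>; with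
        \<open>s i = s j\<close> their images would have the nonzero sum
        \<open>Elt (s i) (s i)\<close>.\<close>
      then have "g (Elt i i) + g (Elt j j) = Theta"
        using hom[of "Elt i i" "Elt j j"] 3(1) by auto
      then show False using s ij by simp
    qed
    ultimately have "s ` {1..n} = {1..n}"
      by (intro endo_inj_surj) auto
    then have s_perm: "s permutes {1..n}"
      using inj by (intro bij_imp_permutes) (auto simp: bij_betw_def s_def)
    have "g (Elt i j) = Elt (s i) (s j)" if ij: "i \<in> {1..n}" "j \<in> {1..n}" for i j
    proof -
      \<comment> \<open>\<open>Elt i i\<close> and \<open>Elt j j\<close> are a left and a right
        identity for \<open>Elt i j\<close>; their images pin down the two indices of its
        value.\<close>
      have "g (Elt i i + Elt i j) = g (Elt i i) + g (Elt i j)"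
        "g (Elt i j + Elt j j) = g (Elt i j) + g (Elt j j)"
        by (rule hom; use ij in simp)+
      then have "Elt (s i) (s i) + g (Elt i j) = g (Elt i j)" "g (Elt i j) + Elt (s j) (s j) = g (Elt i j)"
        using s[OF ij(1)] s[OF ij(2)] by simp_all
      then show ?thesis
        using 3(2)[OF ij] unfolding Elt_add_eq_self add_Elt_eq_self by auto
    qed
    then have "g = index_map n s"
      using 3(1) by (intro maps_eqI[OF gm index_map_in_maps[OF s_perm]]) auto
    then show thesis using perm s_perm by blast
  qed
qed

section \<open>Affine maps\<close>

lemma const_map_endo: "c \<in> brandt n \<Longrightarrow> c + c = c \<Longrightarrow> const_map n c \<in> endos n"
  by (simp add: endos_def const_map_in_maps brandt_add_closed)

lemma index_map_endo:
  assumes "s permutes {1..n}"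
  shows "index_map n s \<in> endos n"
  unfolding endos_def
proof (intro CollectI conjI ballI)
  show "index_map n s \<in> maps n" by (rule index_map_in_maps[OF assms])
  show "index_map n s (a + b) = index_map n s a + index_map n s b"
    if "a \<in> brandt n" "b \<in> brandt n" for a b
    using that permutes_inj[OF assms] by (cases a; cases b) (auto simp: inj_eq)
qed

lemma add_const_const:
  "a \<in> brandt n \<Longrightarrow> b \<in> brandt n \<Longrightarrow>
    pointwise_add n (const_map n a) (const_map n b) = const_map n (a + b)"
  by (intro maps_eqI[OF pointwise_add_in_maps]) (auto intro: const_map_in_maps brandt_add_closed)

lemma add_index_const:
  assumes "s permutes {1..n}" "k \<in> {1..n}" "q \<in> {1..n}"
  shows "pointwise_add n (index_map n s) (const_map n (Elt (s k) q)) = column_map n k q s"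
proof (rule maps_eqI)
  show "pointwise_add n (index_map n s) (const_map n (Elt (s k) q)) \<in> maps n"
    using assms permutes_atLeastAtMost_mem[OF assms(1)]
    by (intro pointwise_add_in_maps index_map_in_maps const_map_in_maps) (simp_all del: atLeastAtMost_iff)
qed (use assms permutes_inj[OF assms(1)] in \<open>auto simp: column_map_in_maps inj_eq\<close>)

lemma column_mapI:
  "k \<in> {1..n} \<Longrightarrow> q \<in> {1..n} \<Longrightarrow> s permutes {1..n} \<Longrightarrow> column_map n k q s \<in> column_maps n"
  unfolding column_maps_def by (rule image_eqI[of _ _ "(k, q, s)"]) simp_all

lemma column_mapsE:
  assumes "f \<in> column_maps n"
  obtains k q s where "k \<in> {1..n}" "q \<in> {1..n}" "s permutes {1..n}" "f = column_map n k q s"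
  using assms unfolding column_maps_def by (elim imageE SigmaE) (simp add: that)

lemma affine_maps_eq: "affine_maps n = const_map n ` brandt n \<union> column_maps n"
proof (intro equalityI subsetI)
  fix f assume "f \<in> affine_maps n"
  then obtain g c where g: "g \<in> endos n" and c: "c \<in> brandt n"
    and f: "f = pointwise_add n g (const_map n c)"
    by (auto simp: affine_maps_def const_maps_eq)
  from g show "f \<in> const_map n ` brandt n \<union> column_maps n"
  proof (cases rule: endo_cases)
    case (const a)
    then show ?thesis using c by (auto simp: f add_const_const brandt_add_closed)
  next
    case (perm s)
    show ?thesis
    proof (cases c)
      case (Elt p q)
      then have pq: "p \<in> {1..n}" "q \<in> {1..n}" using c by auto
      define k where "k = inv s p"
      have k: "k \<in> {1..n}" "s k = p"
        unfolding k_def using permutes_atLeastAtMost_mem[OF permutes_inv[OF perm(1)] pq(1)]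
          permutes_inverses(1)[OF perm(1)] by auto
      then have "f = column_map n k q s"
        using add_index_const[OF perm(1) k(1) pq(2)] by (simp add: f perm(2) Elt)
      then show ?thesis using column_mapI[OF k(1) pq(2) perm(1)] by simp
    next
      case Theta
      have "f = const_map n Theta"
        unfolding f perm(2) Theta
        by (rule maps_eqI[OF pointwise_add_in_maps[OF index_map_in_maps[OF perm(1)]]])
          (simp_all add: const_map_in_maps)
      then show ?thesis by simp
    qed
  qed
next
  fix f assume "f \<in> const_map n ` brandt n \<union> column_maps n"
  then show "f \<in> affine_maps n"
  proof
    assume "f \<in> const_map n ` brandt n"
    then obtain c where c: "c \<in> brandt n" "f = const_map n c" by blast
    obtain e where e: "e \<in> brandt n" "e + e = e" "e + c = c"
    proof (cases c)
      case (Elt p q)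
      then show thesis using c that[of "Elt p p"] by auto
    qed (use that[of Theta] in auto)
    then have "f = pointwise_add n (const_map n e) (const_map n c)"
      using c by (simp add: add_const_const)
    then show ?thesis
      using const_map_endo e c unfolding affine_maps_def const_maps_eq by blast
  next
    assume "f \<in> column_maps n"
    then obtain k q s where k: "k \<in> {1..n}" "q \<in> {1..n}" "s permutes {1..n}"
      and f: "f = column_map n k q s" by (rule column_mapsE)
    have "Elt (s k) q \<in> brandt n"
      using permutes_atLeastAtMost_mem[OF k(3,1)] k(2) by simp
    then show ?thesis
      using index_map_endo[OF k(3)] add_index_const[OF k(3,1,2), symmetric] f
      unfolding affine_maps_def const_maps_eq by blast
  qed
qed

lemma small_mapsI:
  assumes "f \<in> maps n" "f Theta = Theta"
    and "\<And>i j k l. i \<in> {1..n} \<Longrightarrow> j \<in> {1..n} \<Longrightarrow> k \<in> {1..n} \<Longrightarrow> l \<in> {1..n} \<Longrightarrow>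
      f (Elt i j) \<noteq> Theta \<Longrightarrow> f (Elt k l) \<noteq> Theta \<Longrightarrow> i = k \<and> j = l"
  shows "f \<in> small_maps n"
  unfolding small_maps_def
proof (intro CollectI conjI ballI impI)
  show "x = y" if xy: "x \<in> brandt n" "y \<in> brandt n" "f x \<noteq> Theta" "f y \<noteq> Theta" for x y
  proof -
    obtain i j k l where "x = Elt i j" "y = Elt k l"
      using xy(3,4) assms(2) by (cases x; cases y) simp_all
    then show ?thesis using xy assms(3)[of i j k l] by simp
  qed
qed (use assms in auto)

lemma small_maps_mono:
  assumes "f \<in> small_maps n" "h \<in> maps n"
    and "\<And>x. x \<in> brandt n \<Longrightarrow> f x = Theta \<Longrightarrow> h x = Theta"
  shows "h \<in> small_maps n"
proof -
  have "f Theta = Theta"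
    and f: "\<And>x y. x \<in> brandt n \<Longrightarrow> y \<in> brandt n \<Longrightarrow> f x \<noteq> Theta \<Longrightarrow> f y \<noteq> Theta \<Longrightarrow> x = y"
    using assms(1) unfolding small_maps_def by blast+
  show ?thesis
    unfolding small_maps_def
  proof (intro CollectI conjI ballI impI)
    show "h Theta = Theta" using \<open>f Theta = Theta\<close> assms(3) by simp
    show "x = y" if "x \<in> brandt n" "y \<in> brandt n" "h x \<noteq> Theta" "h y \<noteq> Theta" for x y
      using that assms(3) by (intro f) auto
  qed (rule assms(2))
qed

lemma small_maps_add:
  assumes "f \<in> maps n" "g \<in> maps n" "f \<in> small_maps n \<or> g \<in> small_maps n"
  shows "pointwise_add n f g \<in> small_maps n"
  using assms(3)
proof
  assume "f \<in> small_maps n"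
  then show ?thesis
    by (rule small_maps_mono) (simp_all add: pointwise_add_in_maps assms(1,2))
next
  assume "g \<in> small_maps n"
  then show ?thesis
    by (rule small_maps_mono) (simp_all add: pointwise_add_in_maps assms(1,2))
qed

lemma small_maps_comp:
  assumes "f \<in> small_maps n" "g \<in> maps n" "g Theta = Theta"
  shows "compose_left n f g \<in> small_maps n"
  using assms(1)
proof (rule small_maps_mono)
  show "compose_left n f g \<in> maps n"
    using assms(1,2) by (intro compose_left_in_maps) (simp_all add: small_maps_def)
qed (simp add: assms(3))

lemma small_maps_eq:
  "small_maps n = insert (const_map n Theta) ((\<lambda>(a, b). single_map n a b) ` (nonzeros n \<times> nonzeros n))"
proof (intro equalityI subsetI)
  fix f assume f: "f \<in> small_maps n"
  then have fm: "f \<in> maps n" "f Theta = Theta" by (auto simp: small_maps_def)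
  show "f \<in> insert (const_map n Theta) ((\<lambda>(a, b). single_map n a b) ` (nonzeros n \<times> nonzeros n))"
  proof (cases "\<exists>a\<in>nonzeros n. f a \<noteq> Theta")
    case True
    then obtain a where a: "a \<in> nonzeros n" "f a \<noteq> Theta" by blast
    then have ab: "a \<in> brandt n" using nonzeros_subset_brandt by blast
    have fa: "f a \<in> nonzeros n" using a maps_mem[OF fm(1) ab] by (auto simp: brandt_eq_insert)
    have uniq: "f x = Theta" if "x \<in> brandt n" "x \<noteq> a" for x
      using f ab a(2) that unfolding small_maps_def by blast
    have "a \<noteq> Theta" using a(2) fm(2) by blast
    then have "f = single_map n a (f a)"
      by (intro maps_eqI[OF fm(1) single_map_in_maps[OF maps_mem[OF fm(1) ab]]])
        (simp_all add: fm(2) uniq)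
    then show ?thesis using a(1) fa by force
  next
    case False
    have "f = const_map n Theta"
      by (rule maps_eqI) (use fm False in \<open>auto intro: const_map_in_maps\<close>)
    then show ?thesis by simp
  qed
next
  fix f assume "f \<in> insert (const_map n Theta) ((\<lambda>(a, b). single_map n a b) ` (nonzeros n \<times> nonzeros n))"
  then show "f \<in> small_maps n"
    using nonzeros_subset_brandt
    by (auto simp: small_maps_def const_map_in_maps split: if_splits intro!: single_map_in_maps)
qed

lemma column_maps_subset_maps: "column_maps n \<subseteq> maps n"
  by (auto elim!: column_mapsE intro!: column_map_in_maps)

lemma add_closed:
  assumes "f \<in> const_map n ` brandt n \<union> column_maps n \<union> small_maps n" (is "_ \<in> ?T")
    and "g \<in> const_map n ` brandt n \<union> column_maps n \<union> small_maps n"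
  shows "pointwise_add n f g \<in> const_map n ` brandt n \<union> column_maps n \<union> small_maps n"
proof -
  have T: "?T \<subseteq> maps n"
    using column_maps_subset_maps by (auto simp: const_map_in_maps small_maps_def)
  then have fg: "f \<in> maps n" "g \<in> maps n" using assms by auto
  note fgm = pointwise_add_in_maps[OF fg]
  consider "f \<in> small_maps n \<or> g \<in> small_maps n"
    | "f \<in> const_map n ` brandt n" "g \<in> const_map n ` brandt n"
    | c where "c \<in> brandt n" "f = const_map n c" "g \<in> column_maps n"
    | c where "f \<in> column_maps n" "c \<in> brandt n" "g = const_map n c"
    | "f \<in> column_maps n" "g \<in> column_maps n"
    using assms by blast
  then show ?thesis
  proof cases
    case 1
    then show ?thesis using small_maps_add[OF fg] by blast
  next
    case 2
    then show ?thesis by (auto simp: add_const_const brandt_add_closed)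
  next
    case (3 c)
    from 3(3) obtain k q s where g: "s permutes {1..n}" "g = column_map n k q s"
      by (rule column_mapsE)
    have "pointwise_add n f g \<in> small_maps n"
      by (rule small_mapsI[OF fgm]; cases c)
        (use 3 g permutes_inj[OF g(1)] in \<open>auto simp: inj_eq split: if_splits\<close>)
    then show ?thesis by blast
  next
    case (4 c)
    from 4(1) obtain k q s where f: "k \<in> {1..n}" "s permutes {1..n}" "f = column_map n k q s"
      by (rule column_mapsE)
    show ?thesis
    proof (cases "\<exists>r. c = Elt q r")
      case True
      then obtain r where c: "c = Elt q r" by blast
      have r: "r \<in> {1..n}" using 4 c by auto
      have "pointwise_add n f g = column_map n k r s"
        by (rule maps_eqI[OF fgm column_map_in_maps[OF f(2) r]]) (use f 4 c in auto)
      then show ?thesis using column_mapI[OF f(1) r f(2)] by simp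
    next
      case False
      have "pointwise_add n f g = const_map n Theta"
        by (rule maps_eqI[OF fgm const_map_in_maps]; cases c) (use f 4 False in auto)
      then show ?thesis by simp
    qed
  next
    case 5
    from 5(1) obtain k q s where f: "f = column_map n k q s"
      by (rule column_mapsE)
    from 5(2) obtain k' q' s' where g: "s' permutes {1..n}" "g = column_map n k' q' s'"
      by (rule column_mapsE)
    have "pointwise_add n f g \<in> small_maps n"
      by (rule small_mapsI[OF fgm])
        (use f g permutes_inj[OF g(1)] in \<open>auto simp: inj_eq split: if_splits\<close>)
    then show ?thesis by blast
  qed
qed

lemma comp_closed:
  assumes "f \<in> const_map n ` brandt n \<union> column_maps n \<union> small_maps n" (is "_ \<in> ?T")
    and "g \<in> const_map n ` brandt n \<union> column_maps n \<union> small_maps n"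
  shows "compose_left n f g \<in> const_map n ` brandt n \<union> column_maps n \<union> small_maps n"
proof -
  have T: "?T \<subseteq> maps n"
    using column_maps_subset_maps by (auto simp: const_map_in_maps small_maps_def)
  then have fg: "f \<in> maps n" "g \<in> maps n" using assms by auto
  note fgm = compose_left_in_maps[OF fg]
  consider c where "c \<in> brandt n" "f = const_map n c"
    | c where "c \<in> brandt n" "g = const_map n c"
    | "f \<in> small_maps n" "g \<in> column_maps n \<union> small_maps n"
    | "f \<in> column_maps n" "g \<in> small_maps n"
    | "f \<in> column_maps n" "g \<in> column_maps n"
    using assms by blast
  then show ?thesis
  proof cases
    case (1 c)
    have gc: "g c \<in> brandt n" using fg 1 maps_mem by blast
    have "compose_left n f g = const_map n (g c)"
      by (rule maps_eqI[OF fgm const_map_in_maps[OF gc]]) (use 1 in auto)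
    then show ?thesis using gc by blast
  next
    case (2 c)
    have "compose_left n f g = const_map n c"
      by (rule maps_eqI[OF fgm const_map_in_maps]) (use 2 fg in \<open>auto simp: maps_mem\<close>)
    then show ?thesis using 2 by blast
  next
    case 3
    then have "g Theta = Theta"
      by (auto simp: small_maps_def elim!: column_mapsE)
    then show ?thesis using small_maps_comp[OF 3(1) fg(2)] by blast
  next
    case 4
    from 4(1) obtain k q s where f: "q \<in> {1..n}" "s permutes {1..n}" "f = column_map n k q s"
      by (rule column_mapsE)
    have "compose_left n f g \<in> small_maps n"
    proof (rule small_mapsI[OF fgm])
      show "compose_left n f g Theta = Theta" using 4(2) f by (simp add: small_maps_def)
      fix i j i' j' assume ij: "i \<in> {1..n}" "j \<in> {1..n}" "i' \<in> {1..n}" "j' \<in> {1..n}"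
        and nz: "compose_left n f g (Elt i j) \<noteq> Theta" "compose_left n f g (Elt i' j') \<noteq> Theta"
      have th: "g Theta = Theta" using 4(2) by (simp add: small_maps_def)
      have "j = k" "j' = k" using nz ij f(3) th by (auto split: if_splits)
      moreover from this have "g (Elt (s i) q) \<noteq> Theta" "g (Elt (s i') q) \<noteq> Theta"
        using nz ij f(3) by auto
      moreover have "Elt (s i) q \<in> brandt n" "Elt (s i') q \<in> brandt n"
        using ij f permutes_atLeastAtMost_mem[OF f(2)] by (simp_all del: atLeastAtMost_iff)
      ultimately have "s i = s i'" using 4(2) unfolding small_maps_def by blast
      then show "i = i' \<and> j = j'"
        using \<open>j = k\<close> \<open>j' = k\<close> permutes_inj[OF f(2)] by (simp add: inj_eq)
    qed
    then show ?thesis by blast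
  next
    case 5
    from 5(1) obtain k q s where f: "k \<in> {1..n}" "q \<in> {1..n}" "s permutes {1..n}"
      "f = column_map n k q s"
      by (rule column_mapsE)
    from 5(2) obtain k' q' s' where g: "q' \<in> {1..n}" "s' permutes {1..n}"
      "g = column_map n k' q' s'" and k': "k' \<in> {1..n}"
      by (rule column_mapsE)
    note sn = permutes_atLeastAtMost_mem[OF f(3)]
    have comp: "compose_left n f g (Elt i j) =
        (if j = k \<and> q = k' then Elt (s' (s i)) q' else Theta)"
      if ij: "i \<in> {1..n}" "j \<in> {1..n}" for i j
      using ij sn[OF ij(1)] f(2) k' by (simp add: f(4) g(3) del: atLeastAtMost_iff)
    have comp_Theta: "compose_left n f g Theta = Theta"
      by (simp add: f(4) g(3))
    have p: "s' \<circ> s permutes {1..n}" by (rule permutes_compose[OF f(3) g(2)])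
    show ?thesis
    proof (cases "q = k'")
      case True
      have "compose_left n f g = column_map n k q' (s' \<circ> s)"
        by (rule maps_eqI[OF fgm column_map_in_maps[OF p g(1)]])
          (simp_all add: comp comp_Theta True del: atLeastAtMost_iff compose_left_apply)
      then show ?thesis using column_mapI[OF f(1) g(1) p] by simp
    next
      case False
      have "compose_left n f g = const_map n Theta"
        by (rule maps_eqI[OF fgm const_map_in_maps])
          (simp_all add: comp comp_Theta False del: atLeastAtMost_iff compose_left_apply)
      then show ?thesis by simp
    qed
  qed
qed

lemma single_map_eq_add:
  assumes "i \<in> {1..n}" "k \<in> {1..n}" "j \<in> {1..n}" "l \<in> {1..n}"
  shows "single_map n (Elt i k) (Elt j l) =
    pointwise_add n (column_map n k i (transpose i j)) (column_map n k l id)"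
proof (rule maps_eqI)
  show "single_map n (Elt i k) (Elt j l) \<in> maps n"
    using assms by (simp add: single_map_in_maps)
  show "pointwise_add n (column_map n k i (transpose i j)) (column_map n k l id) \<in> maps n"
    by (intro pointwise_add_in_maps column_map_in_maps permutes_swap_id permutes_id assms)
qed (use assms in auto)

lemma A_plus_eq: "A_plus n = const_map n ` brandt n \<union> column_maps n \<union> small_maps n"
proof (intro equalityI subsetI)
  fix f assume "f \<in> A_plus n"
  then show "f \<in> const_map n ` brandt n \<union> column_maps n \<union> small_maps n"
  proof (induction rule: A_plus.induct)
    case (affine f)
    then show ?case by (simp add: affine_maps_eq)
  next
    case (add f g)
    then show ?case by (intro add_closed)
  next
    case (comp f g)
    then show ?case by (intro comp_closed)
  qed
next
  fix f assume f: "f \<in> const_map n ` brandt n \<union> column_maps n \<union> small_maps n"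
  have aff: "g \<in> A_plus n" if "g \<in> const_map n ` brandt n \<union> column_maps n" for g
    using that A_plus.affine by (simp add: affine_maps_eq)
  have "f \<in> A_plus n" if f: "f \<in> small_maps n"
  proof -
    consider "f = const_map n Theta"
      | i k j l where "i \<in> {1..n}" "k \<in> {1..n}" "j \<in> {1..n}" "l \<in> {1..n}"
        "f = single_map n (Elt i k) (Elt j l)"
      using f unfolding small_maps_eq nonzeros_def by fast
    then show ?thesis
    proof cases
      case 1
      then show ?thesis using aff by simp
    next
      case 2
      then have "column_map n k i (transpose i j) \<in> column_maps n"
        "column_map n k l id \<in> column_maps n"
        by (auto intro!: column_mapI permutes_swap_id permutes_id simp del: One_nat_def)
      then show ?thesis
        unfolding 2(5) single_map_eq_add[OF 2(1-4)] by (intro A_plus.add aff UnI2)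
    qed
  qed
  then show "f \<in> A_plus n" using f aff by blast
qed

lemma supp_const_map: "c \<noteq> Theta \<Longrightarrow> supp n (const_map n c) = brandt n"
  by (auto simp: supp_def)

lemma supp_const_map_Theta: "supp n (const_map n Theta) = {}"
  by (auto simp: supp_def)

lemma supp_column_map:
  assumes "k \<in> {1..n}"
  shows "supp n (column_map n k q s) = (\<lambda>i. Elt i k) ` {1..n}"
proof (intro equalityI subsetI)
  fix x assume "x \<in> supp n (column_map n k q s)"
  then show "x \<in> (\<lambda>i. Elt i k) ` {1..n}"
    by (cases x) (auto simp: supp_def split: if_splits)
qed (use assms in \<open>auto simp: supp_def\<close>)

lemma supp_single_map: "a \<in> brandt n \<Longrightarrow> b \<noteq> Theta \<Longrightarrow> supp n (single_map n a b) = {a}"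
  by (auto simp: supp_def split: if_splits)

lemma card_column_maps:
  assumes "n \<ge> 1"
  shows "card (column_maps n) = fact n * n ^ 2"
proof -
  have "inj_on (\<lambda>(k, q, s). column_map n k q s) ({1..n} \<times> {1..n} \<times> {s. s permutes {1..n}})"
  proof (rule inj_onI)
    fix x y
    assume xy: "x \<in> {1..n} \<times> {1..n} \<times> {s. s permutes {1..n}}"
        "y \<in> {1..n} \<times> {1..n} \<times> {s. s permutes {1..n}}"
      and fxy: "(\<lambda>(k, q, s). column_map n k q s) x = (\<lambda>(k, q, s). column_map n k q s) y"
    obtain k q s k' q' s' where x: "x = (k, q, s)" and y: "y = (k', q', s')"
      by (cases x; cases y) blast
    have k: "k \<in> {1..n}" "k' \<in> {1..n}" and s: "s permutes {1..n}" "s' permutes {1..n}"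
      using xy by (simp_all add: x y)
    have eq: "column_map n k q s = column_map n k' q' s'"
      using fxy by (simp add: x y)
    have ap: "column_map n k q s (Elt i k) = column_map n k' q' s' (Elt i k)" for i
      using eq by simp
    have one: "1 \<in> {1..n}" using assms by simp
    from ap[of 1] have "k = k'" "q = q'"
      using k one by (auto split: if_splits)
    moreover have "s i = s' i" for i
    proof (cases "i \<in> {1..n}")
      case True
      then show ?thesis using ap[of i] k \<open>k = k'\<close> by simp
    qed (use s in \<open>simp add: permutes_def\<close>)
    ultimately show "x = y" by (auto simp: x y)
  qed
  then show ?thesis
    unfolding column_maps_def
    by (simp add: card_image card_cartesian_product card_permutations power2_eq_square)
qed

lemma card_single_maps:
  "card ((\<lambda>(a, b). single_map n a b) ` (nonzeros n \<times> nonzeros n)) = n ^ 4"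
proof -
  have "inj_on (\<lambda>(a, b). single_map n a b) (nonzeros n \<times> nonzeros n)"
  proof (rule inj_onI, clarify)
    fix a b a' b'
    assume a: "a \<in> nonzeros n" and b: "b \<in> nonzeros n"
      and eq: "single_map n a b = single_map n a' b'"
    have "a \<in> brandt n" using a nonzeros_subset_brandt by blast
    then have "b = (if a = a' then b' else Theta)"
      using fun_cong[OF eq, of a] by simp
    then show "a = a' \<and> b = b'" using b by (auto split: if_splits)
  qed
  then show ?thesis
    by (simp add: card_image card_cartesian_product card_nonzeros flip: power_add)
qed

lemma card_const_maps: "card (const_map n ` nonzeros n) = n ^ 2"
proof -
  have "inj_on (const_map n) (nonzeros n)"
    by (rule inj_onI) (metis const_map_apply Theta_in_brandt)
  then show ?thesis by (simp add: card_image card_nonzeros)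
qed

theorem theorem2p15:
  fixes n :: nat
  assumes "n \<ge> 2"
  shows "card (A_plus n) = (fact n + 1) * n ^ 2 + n ^ 4 + 1
    \<and> (\<forall>f \<in> A_plus n. of_support n (n ^ 2 + 1) f \<or> of_support n n f
          \<or> of_support n 1 f \<or> of_support n 0 f)
    \<and> card {f \<in> A_plus n. of_support n (n ^ 2 + 1) f} = n ^ 2
    \<and> card {f \<in> A_plus n. of_support n n f} = fact n * n ^ 2
    \<and> card {f \<in> A_plus n. of_support n 1 f} = n ^ 4
    \<and> card {f \<in> A_plus n. of_support n 0 f} = 1"
proof -
  define C where "C = const_map n ` nonzeros n"
  define S where "S = (\<lambda>(a, b). single_map n a b) ` (nonzeros n \<times> nonzeros n)"
  define P where "P = column_maps n"
  define Z where "Z = {const_map n Theta}"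
  have A: "A_plus n = C \<union> P \<union> S \<union> Z"
    unfolding A_plus_eq small_maps_eq C_def S_def P_def Z_def brandt_eq_insert by auto
  have cC: "card C = n ^ 2" and cP: "card P = fact n * n ^ 2" and cS: "card S = n ^ 4"
    and cZ: "card Z = 1"
    using card_const_maps card_column_maps card_single_maps assms
    by (auto simp: C_def P_def S_def Z_def)
  have C: "card (supp n f) = n ^ 2 + 1" if f: "f \<in> C" for f
  proof -
    obtain c where "c \<in> nonzeros n" "f = const_map n c" using f unfolding C_def by blast
    moreover from this have "c \<noteq> Theta" using Theta_notin_nonzeros by metis
    ultimately show ?thesis by (simp add: supp_const_map brandt_eq_insert card_nonzeros)
  qed
  have P: "card (supp n f) = n" if f: "f \<in> P" for f
  proof -
    obtain k where "supp n f = (\<lambda>i. Elt i k) ` {1..n}"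
      using f supp_column_map unfolding P_def by (metis column_mapsE)
    then show ?thesis by (simp add: card_image inj_on_def)
  qed
  have S: "card (supp n f) = 1" if f: "f \<in> S" for f
  proof -
    obtain a b where "a \<in> nonzeros n" "b \<in> nonzeros n" "f = single_map n a b"
      using f unfolding S_def by fast
    moreover from this have "a \<in> brandt n" "b \<noteq> Theta"
      using nonzeros_subset_brandt Theta_notin_nonzeros by (blast, metis)
    ultimately show ?thesis by (simp add: supp_single_map)
  qed
  have Z: "card (supp n f) = 0" if "f \<in> Z" for f
    using that by (auto simp: Z_def supp_const_map_Theta)
  have "n < n ^ 2 + 1" by (simp add: less_Suc_eq_le power2_nat_le_imp_le power2_eq_square)
  then have ne: "n \<noteq> n ^ 2 + 1" "n ^ 2 + 1 \<noteq> 1" "n ^ 2 + 1 \<noteq> 0" "n \<noteq> 1" "n \<noteq> 0"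
    using assms by auto
  have eqs: "{f \<in> A_plus n. of_support n (n ^ 2 + 1) f} = C"
    "{f \<in> A_plus n. of_support n n f} = P"
    "{f \<in> A_plus n. of_support n 1 f} = S"
    "{f \<in> A_plus n. of_support n 0 f} = Z"
    unfolding A of_support_def using C P S Z ne by fastforce+
  have fin: "finite C" "finite P" "finite S" "finite Z"
    using cC cP cS cZ assms by (auto intro!: card_ge_0_finite)
  have dis: "C \<inter> P = {}" "(C \<union> P) \<inter> S = {}" "(C \<union> P \<union> S) \<inter> Z = {}"
    using C P S Z ne by fastforce+
  have "card (A_plus n) = card C + card P + card S + card Z"
    unfolding A using fin dis by (simp add: card_Un_disjoint)
  then have "card (A_plus n) = (fact n + 1) * n ^ 2 + n ^ 4 + 1"
    by (simp add: cC cP cS cZ algebra_simps)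
  moreover have "\<forall>f \<in> A_plus n. of_support n (n ^ 2 + 1) f \<or> of_support n n f
          \<or> of_support n 1 f \<or> of_support n 0 f"
    unfolding A of_support_def by (auto simp: C P S Z)
  ultimately show ?thesis
    unfolding eqs using cC cP cS cZ by simp
qed

end
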